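(* For every prime $n\ge5$, the polynomial $$p_n(z;x,y)-(x+y+z)^n\in\mathbb{Z}[x,y,z]$$ is divisible by $n^4xyz$ in $\mathbb{Z}[x,y,z]$.
   Context: $p_n(z;x,y)=\prod_{r,s=1}^n(\sqrt[n]{z}+\epsilon^r\sqrt[n]{x}+\epsilon^s\sqrt[n]{y})$, where $\epsilon$ is a primitive $n$-th root of unity; this is a homogeneous symmetric polynomial of degree $n$ in $x,y,z$ with integer coefficients. Equivalently, $p_n(z;x,y)=\prod_{r=1}^n\bigl(z-(-1)^n(\sqrt[n]{x}+\epsilon^r\sqrt[n]{y})^n\bigr)$. *)

theory Defs
  imports "HOL-Analysis.Analysis" "HOL-Computational_Algebra.Computational_Algebra"
begin

definition primitive_root_of_unity :: "nat \<Rightarrow> complex \<Rightarrow> bool" where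
  "primitive_root_of_unity n \<epsilon> \<longleftrightarrow> \<epsilon> ^ n = 1 \<and> (\<forall>k. 0 < k \<and> k < n \<longrightarrow> \<epsilon> ^ k \<noteq> 1)"

text \<open>
  The ring \<open>\<int>[x,y,z]\<close> is rendered as the iterated polynomial ring \<open>\<int>[x][y][z]\<close>,
  with \<open>x\<close> the innermost and \<open>z\<close> the outermost variable.
\<close>

type_synonym int_poly3 = "int poly poly poly"

definition var_x :: int_poly3 where "var_x = [:[:[:0, 1:]:]:]"
definition var_y :: int_poly3 where "var_y = [:[:0, 1:]:]"
definition var_z :: int_poly3 where "var_z = [:0, 1:]"

definition eval3 :: "int_poly3 \<Rightarrow> complex \<Rightarrow> complex \<Rightarrow> complex \<Rightarrow> complex" where
  "eval3 P x y z =
     poly (poly (poly (map_poly (map_poly (map_poly of_int)) P) [:[:z:]:]) [:y:]) x"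

text \<open>
  \<open>P\<close> is the integer polynomial given by the product formula in the \<open>n\<close>-th roots
  \<open>a, b, c\<close> of \<open>x, y, z\<close>: the identity is required for all complex
  \<open>x, y, z\<close> and every choice of their \<open>n\<close>-th roots.
\<close>

definition is_p_poly :: "nat \<Rightarrow> complex \<Rightarrow> int_poly3 \<Rightarrow> bool" where
  "is_p_poly n \<epsilon> P \<longleftrightarrow>
     (\<forall>x y z a b c. a ^ n = x \<and> b ^ n = y \<and> c ^ n = z \<longrightarrow>
        eval3 P x y z = (\<Prod>r=1..n. \<Prod>s=1..n. c + \<epsilon> ^ r * a + \<epsilon> ^ s * b))"

definition p_poly :: "nat \<Rightarrow> complex \<Rightarrow> int_poly3" where
  "p_poly n \<epsilon> = (THE P. is_p_poly n \<epsilon> P)"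

text \<open>At most one polynomial satisfies the description.\<close>

lemma poly_const_eqI:
  fixes p q :: "'a :: {idom, ring_char_0} poly poly"
  assumes "\<And>y. poly p [:y:] = poly q [:y:]"
  shows "p = q"
proof (rule ccontr)
  assume "p \<noteq> q"
  then have "p - q \<noteq> 0" by simp
  then have "finite {u. poly (p - q) u = 0}" by (rule poly_roots_finite)
  moreover have "range (\<lambda>y. [:y:]) \<subseteq> {u. poly (p - q) u = 0}" using assms by auto
  ultimately have "finite (range (\<lambda>y :: 'a. [:y:]))" by (rule rev_finite_subset)
  then have "finite (UNIV :: 'a set)" by (rule finite_imageD) (simp add: inj_on_def)
  then show False using infinite_UNIV_char_0 by blast
qed

lemma map_poly_injI:
  assumes "inj f" "f 0 = 0"
  shows "inj (map_poly f)"
proof (rule injI)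
  fix p q assume "map_poly f p = map_poly f q"
  then have "f (coeff p k) = f (coeff q k)" for k
    by (metis assms(2) coeff_map_poly)
  then show "p = q" using assms(1) by (simp add: inj_eq poly_eq_iff)
qed

lemma eval3_eqI:
  assumes "\<And>x y z. eval3 P x y z = eval3 Q x y z"
  shows "P = Q"
proof -
  let ?h = "map_poly (map_poly (map_poly (of_int :: int \<Rightarrow> complex)))"
  have "poly (poly (?h P) [:[:z:]:]) [:y:] = poly (poly (?h Q) [:[:z:]:]) [:y:]" for y z
    using assms unfolding eval3_def by (metis poly_eq_poly_eq_iff ext)
  then have *: "poly (?h P) [:[:z:]:] = poly (?h Q) [:[:z:]:]" for z
    by (intro poly_const_eqI)
  have "?h P = ?h Q"
  proof (rule ccontr)
    assume "?h P \<noteq> ?h Q"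
    then have "?h P - ?h Q \<noteq> 0" by simp
    then have "finite {u. poly (?h P - ?h Q) u = 0}" by (rule poly_roots_finite)
    moreover have "range (\<lambda>z. [:[:z:]:]) \<subseteq> {u. poly (?h P - ?h Q) u = 0}" using * by auto
    ultimately have "finite (range (\<lambda>z :: complex. [:[:z:]:]))" by (rule rev_finite_subset)
    then have "finite (UNIV :: complex set)" by (rule finite_imageD) (simp add: inj_on_def)
    then show False using infinite_UNIV_char_0 by blast
  qed
  moreover have "inj ?h" by (intro map_poly_injI) (auto simp: inj_on_def)
  ultimately show ?thesis by (simp add: inj_eq)
qed

lemma is_p_poly_unique:
  assumes "n > 0" "is_p_poly n \<epsilon> P" "is_p_poly n \<epsilon> Q"
  shows "P = Q"
proof (rule eval3_eqI)
  fix x y z :: complex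
  have "\<exists>u. u ^ n = w" for w :: complex
    using assms(1) by (metis exists_complex_root gr_implies_not0)
  then obtain a b c where "a ^ n = x" "b ^ n = y" "c ^ n = z" by metis
  then show "eval3 P x y z = eval3 Q x y z"
    using assms(2,3) unfolding is_p_poly_def by auto
qed

lemma p_poly_eqI: "n > 0 \<Longrightarrow> is_p_poly n \<epsilon> P \<Longrightarrow> p_poly n \<epsilon> = P"
  unfolding p_poly_def using is_p_poly_unique by blast

end

(*
  Let Z = x + y + z, a^n = x, b^n = y. For odd n the double product collapses to the product over
  r < n of z + (a + e^r b)^n = sum_{k<n} d_k e^(r k), where d_0 = Z and
  d_k = (n choose k) a^(n-k) b^k. Expanding over functions kappa : {0..n-1} -> {0..n-1} gives the
  terms (prod_r d_(kappa r)) e^(sum_r r kappa r). Averaging over the affine group of Z/n removes the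
  roots of unity and leaves a polynomial with integer coefficients.

  A term whose function has a support of size j > 0 is divisible by n^j x y. Size 0 gives Z^n, size 1
  does not occur, and sizes at least 4 are harmless. For j = 2, 3, counting pairs of a function
  and a point of its support gives j V_j = n V'_j, where V'_j runs over the functions with 0 in their
  support; V'_3 is divisible by n^3 x y, and V'_2 is a multiple of x y sum_{0<k<n} (n choose k)^2,
  which n^3 divides by a Wolstenholme-type congruence. Finally, at z = 0 the product is (x + y)^n, so
  z divides the difference as well.
*)

theory Submission
  imports Defs "HOL-Number_Theory.Cong"
begin

subsection \<open>Evaluation is a ring homomorphism\<close>

text \<open>Stated for arbitrary coefficient maps, since \<open>eval3\<close> nests
  \<open>map_poly\<close> three times and each level serves as the \<open>f\<close> of the
  next.\<close>

lemma map_poly_hom_add: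
  fixes f :: "'a::comm_ring_1 \<Rightarrow> 'b::comm_ring_1"
  assumes "f 0 = 0" "\<And>u v. f (u + v) = f u + f v"
  shows "map_poly f (p + q) = map_poly f p + map_poly f q"
  by (rule poly_eqI) (simp add: coeff_map_poly assms)

lemma map_poly_hom_mult:
  fixes f :: "'a::comm_ring_1 \<Rightarrow> 'b::comm_ring_1"
  assumes "f 0 = 0" "\<And>u v. f (u + v) = f u + f v" "\<And>u v. f (u * v) = f u * f v"
  shows "map_poly f (p * q) = map_poly f p * map_poly f q"
proof -
  have "f (sum g A) = (\<Sum>i\<in>A. f (g i))" for g :: "nat \<Rightarrow> 'a" and A
    by (induction A rule: infinite_finite_induct) (simp_all add: assms)
  then show ?thesis
    by (intro poly_eqI) (simp add: coeff_map_poly coeff_mult assms)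
qed

lemma eval3_add: "eval3 (P + Q) x y z = eval3 P x y z + eval3 Q x y z"
  by (simp add: eval3_def map_poly_hom_add)

lemma eval3_mult: "eval3 (P * Q) x y z = eval3 P x y z * eval3 Q x y z"
  by (simp add: eval3_def map_poly_hom_add map_poly_hom_mult)

lemma eval3_0: "eval3 0 x y z = 0"
  by (simp add: eval3_def)

lemma eval3_1: "eval3 1 x y z = 1"
  by (simp add: eval3_def map_poly_1)

lemma eval3_uminus: "eval3 (- P) x y z = - eval3 P x y z"
  using eval3_add[of P "- P" x y z] by (simp add: eval3_0 eq_neg_iff_add_eq_0 add.commute)

lemma eval3_power: "eval3 (P ^ k) x y z = eval3 P x y z ^ k"
  by (induction k) (simp_all add: eval3_1 eval3_mult)

lemma eval3_sum: "eval3 (sum F A) x y z = (\<Sum>i\<in>A. eval3 (F i) x y z)"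
  by (induction A rule: infinite_finite_induct) (simp_all add: eval3_0 eval3_add)

lemma eval3_of_nat: "eval3 (of_nat k) x y z = of_nat k"
  by (induction k) (simp_all add: eval3_0 eval3_1 eval3_add)

lemma eval3_vars:
  "eval3 var_x x y z = x" "eval3 var_y x y z = y" "eval3 var_z x y z = z"
  by (simp_all add: eval3_def var_x_def var_y_def var_z_def map_poly_pCons)

lemmas eval3_simps = eval3_add eval3_mult eval3_0 eval3_1 eval3_uminus eval3_power eval3_sum
  eval3_of_nat eval3_vars

text \<open>As z is the outermost variable, \<open>P\<close> is a polynomial in x and y plus a
  multiple of z. The former takes the same value for every z, so it vanishes everywhere and is zero
  by \<open>eval3_eqI\<close>.\<close>

lemma var_z_dvd_if_eval3_eq_0:
  assumes "\<And>x y. eval3 P x y 0 = 0"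
  shows "var_z dvd P"
proof -
  obtain c R where P: "P = [:c:] + var_z * R"
    by (cases P) (auto simp: var_z_def)
  have "eval3 [:c:] x y z = eval3 [:c:] x y 0" for x y z
    by (simp add: eval3_def map_poly_pCons)
  also have "eval3 [:c:] x y 0 = 0" for x y
    using assms[of x y] by (simp add: P eval3_simps)
  finally have "[:c:] = 0"
    by (intro eval3_eqI) (simp add: eval3_0)
  then show ?thesis
    using P by simp
qed

subsection \<open>Exponent functions and affine substitutions\<close>

text \<open>Precomposition with a permutation of \<open>A\<close> permutes the functions from
  \<open>A\<close> to \<open>B\<close>; \<open>restrict\<close> keeps them extensional, hence inside
  \<open>PiE\<close>.\<close>

lemma sum_PiE_reindex:
  assumes "bij_betw \<pi> A A"
  shows "(\<Sum>\<kappa>\<in>PiE A (\<lambda>_. B). F (restrict (\<kappa> \<circ> \<pi>) A)) = (\<Sum>\<kappa>\<in>PiE A (\<lambda>_. B). F \<kappa>)"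
proof (rule sum.reindex_bij_witness[where i = "\<lambda>\<kappa>. restrict (\<kappa> \<circ> inv_into A \<pi>) A"
        and j = "\<lambda>\<kappa>. restrict (\<kappa> \<circ> \<pi>) A"])
  have mem: "\<pi> r \<in> A" "inv_into A \<pi> r \<in> A" if "r \<in> A" for r
    using that assms bij_betwE[OF assms] bij_betwE[OF bij_betw_inv_into[OF assms]] by auto
  fix \<kappa> assume K: "\<kappa> \<in> PiE A (\<lambda>_. B)"
  show "restrict (restrict (\<kappa> \<circ> \<pi>) A \<circ> inv_into A \<pi>) A = \<kappa>"
    using K mem assms by (auto simp: fun_eq_iff restrict_def PiE_def extensional_def
        bij_betw_inv_into_right)
  show "restrict (restrict (\<kappa> \<circ> inv_into A \<pi>) A \<circ> \<pi>) A = \<kappa>"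
    using K mem assms by (auto simp: fun_eq_iff restrict_def PiE_def extensional_def
        bij_betw_inv_into_left)
  show "restrict (\<kappa> \<circ> \<pi>) A \<in> PiE A (\<lambda>_. B)" "restrict (\<kappa> \<circ> inv_into A \<pi>) A \<in> PiE A (\<lambda>_. B)"
    using K mem by (auto simp: PiE_def Pi_def)
qed simp

lemma bij_betw_affine_mod:
  fixes n u s :: nat
  assumes "coprime u n" "n > 0"
  shows "bij_betw (\<lambda>r. (u * r + s) mod n) {..<n} {..<n}"
proof -
  have "inj_on (\<lambda>r. (u * r + s) mod n) {..<n}"
  proof (rule inj_onI)
    fix r t assume "r \<in> {..<n}" "t \<in> {..<n}" and eq: "(u * r + s) mod n = (u * t + s) mod n"
    then have "[u * r = u * t] (mod n)"
      by (simp flip: cong_def add: cong_add_rcancel_nat)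
    then have "[r = t] (mod n)"
      using assms by (simp add: cong_mult_lcancel_nat coprime_commute)
    with \<open>r \<in> _\<close> \<open>t \<in> _\<close> show "r = t" by (simp add: cong_def)
  qed
  moreover from this have "(\<lambda>r. (u * r + s) mod n) ` {..<n} = {..<n}"
    using assms by (intro endo_inj_surj) auto
  ultimately show ?thesis by (simp add: bij_betw_def)
qed

definition expfuns :: "nat \<Rightarrow> (nat \<Rightarrow> nat) set" where
  "expfuns n = PiE {..<n} (\<lambda>_. {..<n})"

definition total_exp :: "nat \<Rightarrow> (nat \<Rightarrow> nat) \<Rightarrow> nat" where
  "total_exp n \<kappa> = (\<Sum>r<n. \<kappa> r)"

text \<open>The power of the root of unity carried by the term of \<open>\<kappa>\<close> in the
  expanded product.\<close>

definition moment :: "nat \<Rightarrow> (nat \<Rightarrow> nat) \<Rightarrow> nat" where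
  "moment n \<kappa> = (\<Sum>r<n. r * \<kappa> r)"

text \<open>As a sum of indicators, rather than a cardinality, it falls under the reindexing of sums
  and under \<open>power_sum\<close>.\<close>

definition supp_size :: "nat \<Rightarrow> (nat \<Rightarrow> nat) \<Rightarrow> nat" where
  "supp_size n \<kappa> = (\<Sum>r<n. of_bool (\<kappa> r \<noteq> 0))"

definition affine_subst :: "nat \<Rightarrow> nat \<Rightarrow> nat \<Rightarrow> (nat \<Rightarrow> nat) \<Rightarrow> nat \<Rightarrow> nat" where
  "affine_subst n u s \<kappa> = restrict (\<kappa> \<circ> (\<lambda>r. (u * r + s) mod n)) {..<n}"

lemma finite_expfuns [simp]: "finite (expfuns n)"
  by (simp add: expfuns_def finite_PiE)

lemma sum_affine_subst:
  assumes "coprime u n" "n > 0"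
  shows "(\<Sum>\<kappa>\<in>expfuns n. F (affine_subst n u s \<kappa>)) = (\<Sum>\<kappa>\<in>expfuns n. F \<kappa>)"
  unfolding expfuns_def affine_subst_def
  by (rule sum_PiE_reindex[OF bij_betw_affine_mod[OF assms]])

lemma sum_lessThan_affine_subst:
  assumes "coprime u n" "n > 0"
  shows "(\<Sum>r<n. f (affine_subst n u s \<kappa> r)) = (\<Sum>r<n. f (\<kappa> r))"
  using sum.reindex_bij_betw[OF bij_betw_affine_mod[OF assms], of "\<lambda>r. f (\<kappa> r)" s]
  by (simp add: affine_subst_def)

lemma prod_lessThan_affine_subst:
  assumes "coprime u n" "n > 0"
  shows "(\<Prod>r<n. f (affine_subst n u s \<kappa> r)) = (\<Prod>r<n. f (\<kappa> r))"
  using prod.reindex_bij_betw[OF bij_betw_affine_mod[OF assms], of "\<lambda>r. f (\<kappa> r)" s]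
  by (simp add: affine_subst_def)

lemma total_exp_affine_subst:
  "coprime u n \<Longrightarrow> n > 0 \<Longrightarrow> total_exp n (affine_subst n u s \<kappa>) = total_exp n \<kappa>"
  using sum_lessThan_affine_subst[of u n "\<lambda>k. k"] by (simp add: total_exp_def)

lemma supp_size_affine_subst:
  "coprime u n \<Longrightarrow> n > 0 \<Longrightarrow> supp_size n (affine_subst n u s \<kappa>) = supp_size n \<kappa>"
  unfolding supp_size_def by (rule sum_lessThan_affine_subst[of u n "\<lambda>k. of_bool (k \<noteq> 0)"])

text \<open>Since \<open>?\<pi> r\<close> is congruent to u r + s, the left side is congruent to the
  sum of \<open>?\<pi> r * \<kappa> (?\<pi> r)\<close>, a rearrangement of the moment. Keeping
  \<open>u\<close> on the left avoids its inverse modulo \<open>n\<close>.\<close>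

lemma moment_affine_subst:
  assumes "coprime u n" "n > 0"
  shows "[u * moment n (affine_subst n u s \<kappa>) + s * total_exp n \<kappa> = moment n \<kappa>] (mod n)"
proof -
  let ?\<pi> = "\<lambda>r. (u * r + s) mod n"
  have total: "total_exp n \<kappa> = (\<Sum>r<n. \<kappa> (?\<pi> r))"
    using total_exp_affine_subst[OF assms, of s \<kappa>] by (simp add: total_exp_def affine_subst_def)
  have "u * moment n (affine_subst n u s \<kappa>) + s * total_exp n \<kappa> = (\<Sum>r<n. (u * r + s) * \<kappa> (?\<pi> r))"
    unfolding total
    by (simp add: moment_def affine_subst_def sum_distrib_left sum.distrib algebra_simps)
  also have "[\<dots> = (\<Sum>r<n. ?\<pi> r * \<kappa> (?\<pi> r))] (mod n)"
    by (intro cong_sum cong_mult) auto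
  also have "(\<Sum>r<n. ?\<pi> r * \<kappa> (?\<pi> r)) = moment n \<kappa>"
    using sum.reindex_bij_betw[OF bij_betw_affine_mod[OF assms], of "\<lambda>r. r * \<kappa> r" s]
    by (simp add: moment_def)
  finally show ?thesis .
qed

subsection \<open>The product over the roots of unity\<close>

lemma power_mod_eq:
  fixes \<epsilon> :: complex
  assumes "\<epsilon> ^ n = 1"
  shows "\<epsilon> ^ (k mod n) = \<epsilon> ^ k"
proof -
  have "\<epsilon> ^ k = \<epsilon> ^ (n * (k div n) + k mod n)" by simp
  also have "\<dots> = \<epsilon> ^ (k mod n)" by (simp only: power_add power_mult assms) simp
  finally show ?thesis by simp
qed

lemma power_cong:
  fixes \<epsilon> :: complex
  shows "\<epsilon> ^ n = 1 \<Longrightarrow> [k = l] (mod n) \<Longrightarrow> \<epsilon> ^ k = \<epsilon> ^ l"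
  by (metis power_mod_eq cong_def)

lemma primitive_root_power_eq_1_iff:
  assumes "primitive_root_of_unity n \<epsilon>" "n > 0"
  shows "\<epsilon> ^ k = 1 \<longleftrightarrow> n dvd k"
  using assms power_mod_eq[of \<epsilon> n k] unfolding primitive_root_of_unity_def dvd_eq_mod_eq_0
  by (metis bot_nat_0.not_eq_extremum mod_less_divisor power_0)

lemma primitive_root_sum:
  assumes "primitive_root_of_unity n \<epsilon>" "n > 0"
  shows "(\<Sum>s<n. \<epsilon> ^ (s * k)) = (if n dvd k then of_nat n else 0)"
proof (cases "n dvd k")
  case True
  then have "\<epsilon> ^ (s * k) = 1" for s
    using primitive_root_power_eq_1_iff[OF assms] by simp
  with True show ?thesis by simp
next
  case False
  have "\<epsilon> ^ (k * n) = 1"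
    using primitive_root_power_eq_1_iff[OF assms] by simp
  then show ?thesis
    using False primitive_root_power_eq_1_iff[OF assms, of k]
    by (simp add: mult.commute[of _ k] power_mult geometric_sum)
qed

lemma inj_on_primitive_root_powers:
  assumes "primitive_root_of_unity n \<epsilon>" "n > 0"
  shows "inj_on (\<lambda>s. \<epsilon> ^ s) {..<n}"
proof (rule linorder_inj_onI')
  fix i j assume ij: "i \<in> {..<n}" "j \<in> {..<n}" "i < j"
  have "\<epsilon> \<noteq> 0"
    using assms by (auto simp: primitive_root_of_unity_def power_0_left)
  then have "\<epsilon> ^ j = \<epsilon> ^ i \<Longrightarrow> \<epsilon> ^ (j - i) = 1"
    using ij by (simp add: power_diff)
  then show "\<epsilon> ^ i \<noteq> \<epsilon> ^ j"
    using ij primitive_root_power_eq_1_iff[OF assms, of "j - i"] by (auto dest: dvd_imp_le)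
qed

text \<open>The n distinct powers of the root are zeros of X^n - 1, so this polynomial and the
  product of the linear factors, both monic of degree n, agree. Substituting w / v and scaling by
  v^n gives the two-variable form.\<close>

lemma prod_diff_primitive_root:
  assumes "primitive_root_of_unity n \<epsilon>" "n > 0"
  shows "(\<Prod>s<n. w - \<epsilon> ^ s * v) = w ^ n - v ^ n"
proof (cases "v = 0")
  case False
  let ?A = "(\<lambda>s. \<epsilon> ^ s) ` {..<n}" and ?p = "\<Prod>s<n. [:- (\<epsilon> ^ s), 1:]"
  let ?q = "monom 1 n - 1 :: complex poly"
  have deg: "degree ?p = n"
    by (subst degree_prod_sum_eq) simp_all
  have eq: "?p = ?q"
  proof (rule poly_eqI_degree_lead_coeff[where A = ?A and n = n])
    have "lead_coeff ?p = 1" by (simp add: lead_coeff_prod)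
    then show "coeff ?p n = coeff ?q n" using deg \<open>n > 0\<close> by simp
    show "degree ?q \<le> n" by (intro degree_diff_le) (simp_all add: degree_monom_le)
    fix z assume "z \<in> ?A"
    then obtain s where s: "s < n" "z = \<epsilon> ^ s" by auto
    then have "poly ?p z = 0" by (auto simp: poly_prod)
    moreover have "z ^ n = 1"
      using s assms by (metis dvd_triv_right power_mult primitive_root_power_eq_1_iff)
    ultimately show "poly ?p z = poly ?q z" by (simp add: poly_monom)
  qed (use deg inj_on_primitive_root_powers[OF assms] in \<open>simp_all add: card_image\<close>)
  have "(\<Prod>s<n. w / v - \<epsilon> ^ s) = poly ?p (w / v)" by (simp add: poly_prod)
  also have "\<dots> = (w / v) ^ n - 1" by (simp add: eq poly_monom)
  finally have "v ^ n * (\<Prod>s<n. w / v - \<epsilon> ^ s) = w ^ n - v ^ n"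
    using False by (simp add: field_simps power_divide)
  moreover have "(\<Prod>s<n. w - \<epsilon> ^ s * v) = (\<Prod>s<n. v * (w / v - \<epsilon> ^ s))"
    using False by (intro prod.cong) (simp_all add: field_simps)
  ultimately show ?thesis by (simp add: prod.distrib)
qed (use \<open>n > 0\<close> in simp)

lemma prod_root_powers_shift:
  fixes \<epsilon> :: complex
  assumes "\<epsilon> ^ n = 1" "n > 0"
  shows "(\<Prod>t<n. f (\<epsilon> ^ (t + r))) = (\<Prod>s<n. f (\<epsilon> ^ s))"
  using prod.reindex_bij_betw[OF bij_betw_affine_mod[of 1 n r], of "\<lambda>s. f (\<epsilon> ^ s)"] assms
  by (simp add: power_mod_eq)

text \<open>Writing s = r + t in the inner product turns the factor into c + e^r (a + e^t b). The
  product over r is then c^n - w^n with w = -(a + e^t b), and odd n makes the sign positive.\<close>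

lemma double_prod_root_powers:
  assumes root: "primitive_root_of_unity n \<epsilon>" and "odd n"
  shows "(\<Prod>r=1..n. \<Prod>s=1..n. c + \<epsilon> ^ r * a + \<epsilon> ^ s * b) =
         (\<Prod>r<n. c ^ n + (a + \<epsilon> ^ r * b) ^ n)"
proof -
  have n: "n > 0" using \<open>odd n\<close> by (simp add: odd_pos)
  have \<epsilon>: "\<epsilon> ^ n = 1" using root by (simp add: primitive_root_of_unity_def)
  \<comment> \<open>A shift by one permutes the roots of unity, so the range from 1 to n may be
    replaced by 0 to n - 1.\<close>
  have from_0: "(\<Prod>s=1..n. f (\<epsilon> ^ s)) = (\<Prod>s<n. f (\<epsilon> ^ s))" for f :: "complex \<Rightarrow> complex"
    using prod_root_powers_shift[OF \<epsilon> n, of f 1]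
    by (simp add: prod.atLeast1_atMost_eq)
  have "(\<Prod>r=1..n. \<Prod>s=1..n. c + \<epsilon> ^ r * a + \<epsilon> ^ s * b) =
        (\<Prod>r<n. \<Prod>s<n. c + \<epsilon> ^ r * a + \<epsilon> ^ s * b)"
    using from_0[of "\<lambda>e. \<Prod>s=1..n. c + e * a + \<epsilon> ^ s * b"]
      from_0[of "\<lambda>e. c + \<epsilon> ^ _ * a + e * b"] by simp
  also have "\<dots> = (\<Prod>r<n. \<Prod>t<n. c + \<epsilon> ^ r * (a + \<epsilon> ^ t * b))"
  proof (rule prod.cong)
    fix r
    show "(\<Prod>s<n. c + \<epsilon> ^ r * a + \<epsilon> ^ s * b) = (\<Prod>t<n. c + \<epsilon> ^ r * (a + \<epsilon> ^ t * b))"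
      using prod_root_powers_shift[OF \<epsilon> n, of "\<lambda>e. c + \<epsilon> ^ r * a + e * b" r]
      by (simp add: power_add algebra_simps)
  qed simp
  also have "\<dots> = (\<Prod>t<n. \<Prod>r<n. c - \<epsilon> ^ r * (- (a + \<epsilon> ^ t * b)))"
    by (subst prod.swap) (simp add: algebra_simps)
  also have "\<dots> = (\<Prod>t<n. c ^ n - (- (a + \<epsilon> ^ t * b)) ^ n)"
    by (subst prod_diff_primitive_root[OF root n]) simp
  also have "\<dots> = (\<Prod>r<n. c ^ n + (a + \<epsilon> ^ r * b) ^ n)"
    unfolding power_minus_odd[OF \<open>odd n\<close>] by simp
  finally show ?thesis .
qed

section \<open>Expansion into exponent functions and averaging over the affine group\<close>

definition binom_coeffs :: "nat \<Rightarrow> complex \<Rightarrow> complex \<Rightarrow> complex \<Rightarrow> nat \<Rightarrow> complex" where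
  "binom_coeffs n a b c k =
     (if k = 0 then a ^ n + b ^ n + c ^ n else of_nat (n choose k) * a ^ (n - k) * b ^ k)"

text \<open>Both end terms of the binomial expansion are free of the root of unity, because e^(r n)
  = 1. They join c^n in the coefficient of index 0, so the indices below \<open>n\<close>
  suffice.\<close>

lemma binomial_root_expansion:
  fixes \<epsilon> :: complex
  assumes "\<epsilon> ^ n = 1" "n > 0"
  shows "c ^ n + (a + \<epsilon> ^ r * b) ^ n = (\<Sum>k<n. binom_coeffs n a b c k * \<epsilon> ^ (r * k))"
proof -
  have split: "{..n} = insert 0 (insert n {1..<n})" "{..<n} = insert 0 {1..<n}"
    using \<open>n > 0\<close> by auto
  have rn: "(\<epsilon> ^ r) ^ n = 1"
    by (metis assms(1) mult.commute power_mult power_one)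
  have "(a + \<epsilon> ^ r * b) ^ n = (\<Sum>k\<le>n. of_nat (n choose k) * (\<epsilon> ^ r * b) ^ k * a ^ (n - k))"
    by (subst add.commute, rule binomial_ring)
  also have "\<dots> = a ^ n + b ^ n +
      (\<Sum>k\<in>{1..<n}. of_nat (n choose k) * (\<epsilon> ^ r * b) ^ k * a ^ (n - k))"
    using \<open>n > 0\<close> by (simp add: split(1) power_mult_distrib rn)
  also have "(\<Sum>k\<in>{1..<n}. of_nat (n choose k) * (\<epsilon> ^ r * b) ^ k * a ^ (n - k)) =
      (\<Sum>k\<in>{1..<n}. binom_coeffs n a b c k * \<epsilon> ^ (r * k))"
    by (intro sum.cong) (auto simp: binom_coeffs_def power_mult_distrib power_mult)
  finally show ?thesis
    by (simp add: split(2)) (simp add: binom_coeffs_def)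
qed

text \<open>
  The coefficient of an exponent function after averaging over the affine group of \<open>\<int>/n\<close>:
  translations leave only those of total exponent divisible by \<open>n\<close>, and by the symmetry under
  dilations the powers \<open>\<epsilon>, \<dots>, \<epsilon>\<^sup>n\<^sup>-\<^sup>1\<close> all carry the same
  coefficient, so that their sum \<open>-1\<close> may be recorded at moment \<open>1\<close>.
\<close>

definition moment_sign :: "nat \<Rightarrow> (nat \<Rightarrow> nat) \<Rightarrow> int" where
  "moment_sign n \<kappa> = (if n dvd total_exp n \<kappa>
     then of_bool (moment n \<kappa> mod n = 0) - of_bool (moment n \<kappa> mod n = 1) else 0)"

lemma moment_affine_subst_dvd:
  assumes "coprime u n" "n > 0" "n dvd total_exp n \<kappa>"
  shows "[u * moment n (affine_subst n u s \<kappa>) = moment n \<kappa>] (mod n)"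
proof -
  have "[u * moment n (affine_subst n u s \<kappa>) + 0 =
      u * moment n (affine_subst n u s \<kappa>) + s * total_exp n \<kappa>] (mod n)"
    using assms(3) by (intro cong_add cong_refl) (simp add: cong_0_iff cong_sym)
  with moment_affine_subst[OF assms(1,2), of s \<kappa>] show ?thesis
    by (metis add_0_right cong_trans)
qed

text \<open>Limited to translations: a dilation can move the recorded moment 1 to another nonzero
  residue.\<close>

lemma moment_sign_shift:
  assumes "n > 0"
  shows "moment_sign n (affine_subst n 1 s \<kappa>) = moment_sign n \<kappa>"
  using moment_affine_subst_dvd[of 1 n \<kappa> s] assms total_exp_affine_subst[of 1 n s \<kappa>]
  by (simp add: moment_sign_def cong_def)

lemma sum_root_powers_eq_sum_moment_sign:
  assumes root: "primitive_root_of_unity n \<epsilon>" and "prime n"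
    and inv: "\<And>u s \<kappa>. coprime u n \<Longrightarrow> D (affine_subst n u s \<kappa>) = (D \<kappa> :: complex)"
  shows "(\<Sum>\<kappa>\<in>expfuns n. D \<kappa> * \<epsilon> ^ moment n \<kappa>) =
         (\<Sum>\<kappa>\<in>expfuns n. of_int (moment_sign n \<kappa>) * D \<kappa>)"
proof -
  have n: "n > 1" "n > 0" using \<open>prime n\<close> prime_gt_1_nat prime_gt_0_nat by auto
  have \<epsilon>: "\<epsilon> ^ n = 1" using root by (simp add: primitive_root_of_unity_def)
  define S where "S = (\<Sum>\<kappa>\<in>expfuns n. D \<kappa> * \<epsilon> ^ moment n \<kappa>)"
  \<comment> \<open>A translation by \<open>s\<close> lowers the moment by s times the total
    exponent modulo n; the extra power compensates for this.\<close>
  have translate: "(\<Sum>\<kappa>\<in>expfuns n. D \<kappa> * \<epsilon> ^ moment n \<kappa> * \<epsilon> ^ (s * total_exp n \<kappa>)) = S" for s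
  proof -
    have "(\<Sum>\<kappa>\<in>expfuns n. D \<kappa> * \<epsilon> ^ moment n \<kappa> * \<epsilon> ^ (s * total_exp n \<kappa>)) =
      (\<Sum>\<kappa>\<in>expfuns n. D \<kappa> * \<epsilon> ^ (moment n (affine_subst n 1 s \<kappa>) + s * total_exp n \<kappa>))"
      by (subst sum_affine_subst[of 1 n _ s, symmetric])
         (simp_all add: n inv total_exp_affine_subst power_add mult_ac)
    also have "\<dots> = S"
      unfolding S_def using moment_affine_subst[of 1 n s] n
      by (intro sum.cong arg_cong2[where f = "(*)"] power_cong[OF \<epsilon>]) simp_all
    finally show ?thesis .
  qed
  \<comment> \<open>Summing over all translations, orthogonality of the roots of unity kills every
    term whose total exponent is not divisible by \<open>n\<close>.\<close>
  have "of_nat n * S =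
      (\<Sum>s<n. \<Sum>\<kappa>\<in>expfuns n. D \<kappa> * \<epsilon> ^ moment n \<kappa> * \<epsilon> ^ (s * total_exp n \<kappa>))"
    by (simp add: translate)
  also have "\<dots> = (\<Sum>\<kappa>\<in>expfuns n. D \<kappa> * \<epsilon> ^ moment n \<kappa> * (\<Sum>s<n. \<epsilon> ^ (s * total_exp n \<kappa>)))"
    by (subst sum.swap) (simp add: sum_distrib_left)
  also have "\<dots> = of_nat n *
      (\<Sum>\<kappa>\<in>expfuns n. of_bool (n dvd total_exp n \<kappa>) * D \<kappa> * \<epsilon> ^ moment n \<kappa>)"
    unfolding primitive_root_sum[OF root n(2)] sum_distrib_left by (intro sum.cong) auto
  finally have S: "S = (\<Sum>\<kappa>\<in>expfuns n. of_bool (n dvd total_exp n \<kappa>) * D \<kappa> * \<epsilon> ^ moment n \<kappa>)"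
    using n by simp
  define G where "G m = (\<Sum>\<kappa>\<in>expfuns n.
      of_bool (n dvd total_exp n \<kappa>) * D \<kappa> * of_bool (moment n \<kappa> mod n = m))" for m
  have "S = (\<Sum>\<kappa>\<in>expfuns n. of_bool (n dvd total_exp n \<kappa>) * D \<kappa> *
      (\<Sum>m<n. of_bool (moment n \<kappa> mod n = m) * \<epsilon> ^ m))"
    unfolding S using n
    by (intro sum.cong refl arg_cong2[where f = "(*)"])
       (simp add: of_bool_def if_distribR if_distrib[of "\<lambda>x. x * _"] power_mod_eq[OF \<epsilon>] cong: if_cong)
  also have "\<dots> = (\<Sum>m<n. G m * \<epsilon> ^ m)"
    by (simp only: G_def sum_distrib_left sum_distrib_right mult.assoc) (rule sum.swap)
  finally have SG: "S = (\<Sum>m<n. G m * \<epsilon> ^ m)" .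
  \<comment> \<open>As \<open>n\<close> is prime, \<open>u\<close> is a unit modulo
    \<open>n\<close>, and the dilation by \<open>u\<close> carries moment \<open>u\<close> to moment
    1 without changing \<open>D\<close> or the total exponent.\<close>
  have G_eq: "G u = G 1" if u: "u \<in> {1..<n}" for u
  proof -
    have cop: "coprime u n"
      using u \<open>prime n\<close> by (metis atLeastLessThan_iff coprime_commute dvd_imp_le leD
          le_simps(3) One_nat_def prime_imp_coprime)
    have "moment n \<kappa> mod n = u \<longleftrightarrow> moment n (affine_subst n u 0 \<kappa>) mod n = 1"
      if "n dvd total_exp n \<kappa>" for \<kappa>
    proof -
      have "moment n \<kappa> mod n = u \<longleftrightarrow> [moment n \<kappa> = u] (mod n)"
        using u by (simp add: cong_def)
      also have "\<dots> \<longleftrightarrow> [u * moment n (affine_subst n u 0 \<kappa>) = u * 1] (mod n)"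
        using moment_affine_subst_dvd[OF cop n(2) that, of 0] by (simp add: cong_def)
      also have "\<dots> \<longleftrightarrow> [moment n (affine_subst n u 0 \<kappa>) = 1] (mod n)"
        using cop by (simp only: cong_mult_lcancel_nat coprime_commute)
      finally show ?thesis using n by (simp add: cong_def)
    qed
    then have "G u = (\<Sum>\<kappa>\<in>expfuns n. of_bool (n dvd total_exp n \<kappa>) * D \<kappa> *
        of_bool (moment n (affine_subst n u 0 \<kappa>) mod n = 1))"
      unfolding G_def by (intro sum.cong) auto
    also have "\<dots> = G 1"
      unfolding G_def
      by (subst sum_affine_subst[OF cop n(2), of _ 0, symmetric])
         (simp add: inv[OF cop] total_exp_affine_subst[OF cop n(2)])
    finally show ?thesis .
  qed
  have split: "(\<Sum>m<n. f m) = f 0 + (\<Sum>m\<in>{1..<n}. f m)" for f :: "nat \<Rightarrow> complex"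
    using n by (simp add: lessThan_atLeast0 sum.atLeast_Suc_lessThan)
  have "S = G 0 + (\<Sum>m\<in>{1..<n}. G m * \<epsilon> ^ m)"
    using split[of "\<lambda>m. G m * \<epsilon> ^ m"] by (simp add: SG)
  also have "(\<Sum>m\<in>{1..<n}. G m * \<epsilon> ^ m) = G 1 * (\<Sum>m\<in>{1..<n}. \<epsilon> ^ m)"
    unfolding sum_distrib_left by (intro sum.cong refl arg_cong2[where f = "(*)"] G_eq)
  \<comment> \<open>All n powers together sum to 0, and the power with exponent 0 is 1.\<close>
  also have "(\<Sum>m\<in>{1..<n}. \<epsilon> ^ m) = -1"
    using primitive_root_sum[OF root n(2), of 1] n split[of "\<lambda>m. \<epsilon> ^ m"]
    by (simp add: eq_neg_iff_add_eq_0 add.commute)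
  also have "G 0 + G 1 * - 1 = (\<Sum>\<kappa>\<in>expfuns n. of_int (moment_sign n \<kappa>) * D \<kappa>)"
    unfolding G_def moment_sign_def
    by (simp add: algebra_simps flip: sum_subtractf) (intro sum.cong; auto)
  finally show ?thesis unfolding S_def .
qed

subsection \<open>The integer polynomial\<close>

text \<open>
  If \<open>n\<close> divides the total exponent, the product of the \<open>binom_coeffs n a b c (\<kappa> r)\<close> over
  \<open>r < n\<close> contains \<open>a\<close> and \<open>b\<close> only through \<open>x = a ^ n\<close> and \<open>y = b ^ n\<close>, and is then this
  polynomial in \<open>x\<close>, \<open>y\<close> and \<open>z = c ^ n\<close>.
\<close>

definition weight :: "nat \<Rightarrow> (nat \<Rightarrow> nat) \<Rightarrow> int_poly3" where
  "weight n \<kappa> = (var_x + var_y + var_z) ^ (n - supp_size n \<kappa>) * of_nat (\<Prod>r<n. n choose \<kappa> r) *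
     var_x ^ (supp_size n \<kappa> - total_exp n \<kappa> div n) * var_y ^ (total_exp n \<kappa> div n)"

lemma weight_affine_subst:
  "coprime u n \<Longrightarrow> n > 0 \<Longrightarrow> weight n (affine_subst n u s \<kappa>) = weight n \<kappa>"
  by (simp add: weight_def supp_size_affine_subst total_exp_affine_subst
      prod_lessThan_affine_subst[where f = "\<lambda>k. n choose k"])

lemma expfuns_lt: "\<kappa> \<in> expfuns n \<Longrightarrow> r < n \<Longrightarrow> \<kappa> r < n"
  by (auto simp: expfuns_def)

lemma supp_size_le: "supp_size n \<kappa> \<le> n"
  using sum_mono[of "{..<n}" "\<lambda>r. of_bool (\<kappa> r \<noteq> 0)" "\<lambda>_. 1 :: nat"]
  by (simp add: supp_size_def)

text \<open>Each point of the support contributes (n - \<kappa> r) + \<kappa> r = n. The first sum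
  is the exponent of a in the product of the coefficients, so it is divisible by n whenever the
  total exponent, the exponent of b, is.\<close>

lemma sum_complement_exponents:
  assumes "\<kappa> \<in> expfuns n"
  shows "(\<Sum>r<n. of_bool (\<kappa> r \<noteq> 0) * (n - \<kappa> r)) + total_exp n \<kappa> = n * supp_size n \<kappa>"
  unfolding total_exp_def supp_size_def sum_distrib_left sum.distrib[symmetric]
  using assms by (intro sum.cong) (auto dest: expfuns_lt)

lemma eval3_weight:
  assumes \<kappa>: "\<kappa> \<in> expfuns n" and dvd: "n dvd total_exp n \<kappa>"
  shows "eval3 (weight n \<kappa>) (a ^ n) (b ^ n) (c ^ n) = (\<Prod>r<n. binom_coeffs n a b c (\<kappa> r))"
proof -
  let ?Z = "a ^ n + b ^ n + c ^ n" and ?t = "total_exp n \<kappa> div n"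
  have zeros: "(\<Sum>r<n. of_bool (\<kappa> r = 0)) = n - supp_size n \<kappa>"
  proof -
    have "(\<Sum>r<n. of_bool (\<kappa> r = 0)) + supp_size n \<kappa> = (\<Sum>r<n. 1)"
      unfolding supp_size_def sum.distrib[symmetric] by (intro sum.cong) auto
    then show ?thesis by simp
  qed
  have t: "n * ?t = total_exp n \<kappa>"
    using dvd by simp
  have compl: "(\<Sum>r<n. of_bool (\<kappa> r \<noteq> 0) * (n - \<kappa> r)) = n * (supp_size n \<kappa> - ?t)"
    using sum_complement_exponents[OF \<kappa>] t by (simp add: diff_mult_distrib2)
  have "(\<Prod>r<n. binom_coeffs n a b c (\<kappa> r)) =
      (\<Prod>r<n. ?Z ^ of_bool (\<kappa> r = 0) * of_nat (n choose \<kappa> r) *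
        a ^ (of_bool (\<kappa> r \<noteq> 0) * (n - \<kappa> r)) * b ^ \<kappa> r)"
    by (intro prod.cong) (auto simp: binom_coeffs_def)
  also have "\<dots> = ?Z ^ (\<Sum>r<n. of_bool (\<kappa> r = 0)) * of_nat (\<Prod>r<n. n choose \<kappa> r) *
      a ^ (\<Sum>r<n. of_bool (\<kappa> r \<noteq> 0) * (n - \<kappa> r)) * b ^ total_exp n \<kappa>"
    by (simp only: prod.distrib power_sum total_exp_def of_nat_prod)
  also have "\<dots> = ?Z ^ (n - supp_size n \<kappa>) * of_nat (\<Prod>r<n. n choose \<kappa> r) *
      (a ^ n) ^ (supp_size n \<kappa> - ?t) * (b ^ n) ^ ?t"
    unfolding zeros compl by (simp only: t flip: power_mult)
  also have "\<dots> = eval3 (weight n \<kappa>) (a ^ n) (b ^ n) (c ^ n)"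
    unfolding weight_def eval3_simps by simp
  finally show ?thesis ..
qed

definition p_int :: "nat \<Rightarrow> int_poly3" where
  "p_int n = (\<Sum>\<kappa>\<in>expfuns n. of_int (moment_sign n \<kappa>) * weight n \<kappa>)"

lemma eval3_of_int: "eval3 (of_int k) x y z = of_int k"
  by (cases k rule: int_cases2) (simp_all add: eval3_simps)

lemma eval3_p_int:
  assumes root: "primitive_root_of_unity n \<epsilon>" and "prime n"
  shows "eval3 (p_int n) (a ^ n) (b ^ n) (c ^ n) = (\<Prod>r<n. c ^ n + (a + \<epsilon> ^ r * b) ^ n)"
proof -
  have n: "n > 0" using \<open>prime n\<close> prime_gt_0_nat by auto
  have \<epsilon>: "\<epsilon> ^ n = 1" using root by (simp add: primitive_root_of_unity_def)
  let ?d = "binom_coeffs n a b c"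
  let ?D = "\<lambda>\<kappa>. \<Prod>r<n. ?d (\<kappa> r)"
  have "eval3 (p_int n) (a ^ n) (b ^ n) (c ^ n) =
      (\<Sum>\<kappa>\<in>expfuns n. of_int (moment_sign n \<kappa>) * eval3 (weight n \<kappa>) (a ^ n) (b ^ n) (c ^ n))"
    by (simp add: p_int_def eval3_sum eval3_mult eval3_of_int)
  also have "\<dots> = (\<Sum>\<kappa>\<in>expfuns n. of_int (moment_sign n \<kappa>) * ?D \<kappa>)"
    \<comment> \<open>Where \<open>eval3_weight\<close> does not apply, n does not divide the total
      exponent and the sign is 0.\<close>
    by (intro sum.cong) (auto simp: moment_sign_def eval3_weight)
  also have "\<dots> = (\<Sum>\<kappa>\<in>expfuns n. ?D \<kappa> * \<epsilon> ^ moment n \<kappa>)"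
    by (rule sum_root_powers_eq_sum_moment_sign[OF root \<open>prime n\<close>, symmetric])
       (rule prod_lessThan_affine_subst[OF _ n])
  also have "\<dots> = (\<Sum>\<kappa>\<in>expfuns n. \<Prod>r<n. ?d (\<kappa> r) * \<epsilon> ^ (r * \<kappa> r))"
    by (simp add: prod.distrib moment_def power_sum)
  also have "\<dots> = (\<Prod>r<n. \<Sum>k<n. ?d k * \<epsilon> ^ (r * k))"
    unfolding expfuns_def by (rule prod_sum_PiE[symmetric]) simp_all
  also have "\<dots> = (\<Prod>r<n. c ^ n + (a + \<epsilon> ^ r * b) ^ n)"
    by (simp add: binomial_root_expansion[OF \<epsilon> n])
  finally show ?thesis .
qed

lemma p_poly_eq_p_int:
  assumes "primitive_root_of_unity n \<epsilon>" "prime n" "odd n"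
  shows "p_poly n \<epsilon> = p_int n"
  using assms(2)
  by (intro p_poly_eqI) (auto simp only: is_p_poly_def prime_gt_0_nat
      eval3_p_int[OF assms(1,2)] double_prod_root_powers[OF assms(1,3)])

lemma var_z_dvd_p_int_diff:
  assumes root: "primitive_root_of_unity n \<epsilon>" and "prime n" "odd n"
  shows "var_z dvd p_int n - (var_x + var_y + var_z) ^ n"
proof (rule var_z_dvd_if_eval3_eq_0)
  fix x y :: complex
  have n: "n > 0" using \<open>prime n\<close> prime_gt_0_nat by auto
  obtain a b where ab: "a ^ n = x" "b ^ n = y"
    using n by (metis exists_complex_root gr_implies_not0)
  have "eval3 (p_int n) x y 0 = (\<Prod>r<n. a + \<epsilon> ^ r * b) ^ n"
    using eval3_p_int[OF root \<open>prime n\<close>, of a b 0] n by (simp add: ab prod_power_distrib zero_power)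
  \<comment> \<open>The factorization of a^n - (-b)^n, with n odd.\<close>
  also have "(\<Prod>r<n. a + \<epsilon> ^ r * b) = x + y"
    using prod_diff_primitive_root[OF root n, of a "- b"] \<open>odd n\<close>
    by (simp add: power_minus_odd ab)
  finally show "eval3 (p_int n - (var_x + var_y + var_z) ^ n) x y 0 = 0"
    by (simp only: diff_conv_add_uminus eval3_simps) simp
qed

subsection \<open>A congruence for the squares of the binomial coefficients\<close>

lemma prime_dvd_binomial:
  "prime n \<Longrightarrow> 0 < k \<Longrightarrow> k < n \<Longrightarrow> n dvd (n choose k)" for n :: nat
  by (rule dvd_choose_prime) auto

text \<open>By Pascal's rule neighbouring entries of row n - 1 add up to an inner entry of row n,
  which n divides; so they alternate in sign modulo n, starting from 1.\<close>

lemma binomial_pred_prime_cong: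
  fixes n :: nat
  assumes "prime n" "k < n"
  shows "[int ((n - 1) choose k) = (- 1) ^ k] (mod int n)"
  using assms(2)
proof (induction k)
  case (Suc k)
  have "n choose Suc k = ((n - 1) choose k) + ((n - 1) choose Suc k)"
    using Suc.prems by (metis Suc_diff_1 binomial_Suc_Suc less_nat_zero_code not_gr_zero)
  then have "[int ((n - 1) choose k) + int ((n - 1) choose Suc k) = 0] (mod int n)"
    using prime_dvd_binomial[OF assms(1), of "Suc k"] Suc.prems
    by (simp add: cong_0_iff flip: of_nat_add)
  moreover have "[int ((n - 1) choose k) = (- 1) ^ k] (mod int n)"
    using Suc by simp
  ultimately have "[(- 1) ^ k + int ((n - 1) choose Suc k) = 0] (mod int n)"
    by (metis cong_add_rcancel cong_sym cong_trans)
  then have "[(- 1) ^ k + int ((n - 1) choose Suc k) - (- 1) ^ k = 0 - (- 1) ^ k] (mod int n)"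
    by (intro cong_diff cong_refl)
  then show ?case by simp
qed simp

text \<open>
  Writing \<open>n choose k = n q\<^sub>k\<close>, the number \<open>q\<^sub>k\<^sup>2\<close> is inverse to \<open>k\<^sup>2\<close> modulo \<open>n\<close>, so the
  dilation by \<open>2\<close> shows that the sum \<open>S\<close> of the \<open>q\<^sub>k\<^sup>2\<close> satisfies \<open>4 S = S\<close> modulo \<open>n\<close>.
\<close>

lemma prime_cube_dvd_sum_binomial_squares:
  fixes n :: nat
  assumes "prime n" "n \<ge> 5"
  shows "n ^ 3 dvd (\<Sum>k\<in>{1..<n}. (n choose k)\<^sup>2)"
proof -
  \<comment> \<open>The value 0 at 0 lets the sums run over all residues, which doubling
    permutes.\<close>
  define q where "q k = (if k = 0 then 0 else (n choose k) div n)" for k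
  have choose_eq: "n choose k = n * q k" if "k \<in> {1..<n}" for k
    using that prime_dvd_binomial[OF assms(1), of k] by (simp add: q_def)
  have inv: "[k\<^sup>2 * (q k)\<^sup>2 = 1] (mod n)" if k: "k \<in> {1..<n}" for k
  proof -
    \<comment> \<open>Absorption makes k q_k an entry of row n - 1, so it is 1 or -1 modulo n;
      squaring removes the sign.\<close>
    have "k * (n choose k) = n * ((n - 1) choose (k - 1))"
      using k by (metis One_nat_def Suc_pred' atLeastLessThan_iff binomial_absorption less_eq_Suc_le)
    then have "k * q k = (n - 1) choose (k - 1)"
      using k by (simp add: choose_eq[OF k] mult.left_commute)
    then have "[(int (k * q k))\<^sup>2 = ((- 1) ^ (k - 1))\<^sup>2] (mod int n)"
      using k by (simp only:) (intro cong_pow binomial_pred_prime_cong[OF assms(1)]; auto)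
    also have "((- 1 :: int) ^ (k - 1))\<^sup>2 = 1"
      by (simp flip: power_mult add: mult.commute[of _ 2] power_mult)
    finally have "[int (k\<^sup>2 * (q k)\<^sup>2) = int 1] (mod int n)"
      by (simp add: power_mult_distrib)
    then show ?thesis by (simp only: cong_int_iff)
  qed
  let ?S = "\<Sum>k<n. (q k)\<^sup>2"
  have cop2: "coprime 2 n"
    using assms primes_coprime[OF two_is_prime_nat assms(1)] by simp
  \<comment> \<open>Both (2k)^2 q_(2k)^2 and k^2 q_k^2 are 1 modulo n, with the index 2k reduced;
    the unit k^2 cancels and leaves the factor 4.\<close>
  have "[4 * (q ((2 * k) mod n))\<^sup>2 = (q k)\<^sup>2] (mod n)" if "k < n" for k
  proof (cases "k = 0")
    case False
    let ?m = "(2 * k) mod n"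
    have k: "k \<in> {1..<n}" using False that by simp
    have nk: "\<not> n dvd k" using k by (auto dest: dvd_imp_le)
    have "\<not> n dvd 2 * k"
      using nk cop2 by (simp add: coprime_dvd_mult_right_iff coprime_commute)
    then have m: "?m \<in> {1..<n}" using assms by (simp add: dvd_eq_mod_eq_0 Suc_le_eq)
    have "[?m = 2 * k] (mod n)" by simp
    then have "[?m\<^sup>2 * (q ?m)\<^sup>2 = (2 * k)\<^sup>2 * (q ?m)\<^sup>2] (mod n)"
      by (intro cong_mult cong_pow cong_refl)
    then have "[k\<^sup>2 * (4 * (q ?m)\<^sup>2) = k\<^sup>2 * (q k)\<^sup>2] (mod n)"
      using inv[OF m] inv[OF k] by (simp add: power_mult_distrib mult_ac) (metis cong_sym cong_trans)
    moreover have "coprime (k\<^sup>2) n"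
      using prime_imp_coprime[OF assms(1) nk] by (simp add: coprime_commute)
    ultimately show ?thesis by (simp add: cong_mult_lcancel_nat coprime_commute)
  qed (simp add: q_def)
  then have "[(\<Sum>k<n. 4 * (q ((2 * k) mod n))\<^sup>2) = ?S] (mod n)"
    by (intro cong_sum) simp
  moreover have "(\<Sum>k<n. 4 * (q ((2 * k) mod n))\<^sup>2) = 4 * ?S"
    using sum.reindex_bij_betw[OF bij_betw_affine_mod[OF cop2, of 0], of "\<lambda>k. (q k)\<^sup>2"] assms
    by (simp flip: sum_distrib_left)
  ultimately have "[4 * ?S = ?S] (mod n)" by simp
  then have "n dvd 3 * ?S" by (simp add: cong_altdef_nat)
  \<comment> \<open>Here n >= 5 excludes the prime 3, so the factor 3 = 4 - 1 cancels.\<close>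
  moreover have "\<not> n dvd 3" using assms by (auto dest: dvd_imp_le)
  ultimately have "n dvd ?S" using assms(1) by (metis prime_dvd_mult_iff)
  moreover have "?S = (\<Sum>k\<in>{1..<n}. (q k)\<^sup>2)"
    using assms by (simp add: lessThan_atLeast0 sum.atLeast_Suc_lessThan q_def)
  moreover have "(\<Sum>k\<in>{1..<n}. (n choose k)\<^sup>2) = n\<^sup>2 * (\<Sum>k\<in>{1..<n}. (q k)\<^sup>2)"
    unfolding sum_distrib_left by (intro sum.cong) (simp_all add: choose_eq power_mult_distrib)
  ultimately show ?thesis
    by (simp add: power3_eq_cube power2_eq_square mult_dvd_mono)
qed

subsection \<open>Divisibility by the size of the support\<close>

definition supp_part :: "nat \<Rightarrow> nat \<Rightarrow> int_poly3" where
  "supp_part n j =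
     (\<Sum>\<kappa>\<in>expfuns n. of_bool (supp_size n \<kappa> = j) * of_int (moment_sign n \<kappa>) * weight n \<kappa>)"

lemma p_int_eq_sum_supp_part: "p_int n = (\<Sum>j\<le>n. supp_part n j)"
proof -
  have "(\<Sum>j\<le>n. supp_part n j) = (\<Sum>\<kappa>\<in>expfuns n. \<Sum>j\<le>n.
      of_bool (supp_size n \<kappa> = j) * (of_int (moment_sign n \<kappa>) * weight n \<kappa>))"
    unfolding supp_part_def mult.assoc by (rule sum.swap)
  also have "\<dots> = p_int n"
    unfolding p_int_def sum_distrib_right[symmetric]
  proof (intro sum.cong refl)
    fix \<kappa>
    have "(\<Sum>j\<le>n. of_bool (supp_size n \<kappa> = j)) = (\<Sum>j\<in>{supp_size n \<kappa>}. 1 :: int_poly3)"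
      using supp_size_le[of n \<kappa>] by (intro sum.mono_neutral_cong_right) auto
    then show "(\<Sum>j\<le>n. of_bool (supp_size n \<kappa> = j)) * (of_int (moment_sign n \<kappa>) * weight n \<kappa>) =
        of_int (moment_sign n \<kappa>) * weight n \<kappa>" by simp
  qed
  finally show ?thesis ..
qed

lemma supp_part_0:
  assumes "n > 1"
  shows "supp_part n 0 = (var_x + var_y + var_z) ^ n"
proof -
  let ?\<kappa> = "restrict (\<lambda>_. 0) {..<n} :: nat \<Rightarrow> nat"
  have zero: "supp_size n \<kappa> = 0 \<longleftrightarrow> \<kappa> = ?\<kappa>" if "\<kappa> \<in> expfuns n" for \<kappa>
    using that by (fastforce simp: supp_size_def expfuns_def restrict_def PiE_def extensional_def)
  have mem: "?\<kappa> \<in> expfuns n"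
    using assms by (auto simp: expfuns_def)
  have "supp_part n 0 = (\<Sum>\<kappa>\<in>{?\<kappa>}. of_int (moment_sign n \<kappa>) * weight n \<kappa>)"
    unfolding supp_part_def using mem
    by (intro sum.mono_neutral_cong_right) (auto simp: zero simp del: sum.insert)
  also have "\<dots> = (var_x + var_y + var_z) ^ n"
    using assms by (simp add: moment_sign_def weight_def supp_size_def total_exp_def moment_def)
  finally show ?thesis .
qed

lemma total_exp_bounds:
  assumes "\<kappa> \<in> expfuns n" "supp_size n \<kappa> > 0"
  shows "0 < total_exp n \<kappa>" "total_exp n \<kappa> < n * supp_size n \<kappa>"
proof -
  from assms(2) obtain r where r: "r < n" "\<kappa> r \<noteq> 0"
    by (auto simp: supp_size_def card_gt_0_iff)
  then show "0 < total_exp n \<kappa>"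
    by (auto simp: total_exp_def intro!: sum_pos2[of _ r])
  have "0 < (\<Sum>r<n. of_bool (\<kappa> r \<noteq> 0) * (n - \<kappa> r))"
    using r expfuns_lt[OF assms(1) r(1)] by (intro sum_pos2[of _ r]) auto
  then show "total_exp n \<kappa> < n * supp_size n \<kappa>"
    using sum_complement_exponents[OF assms(1)] by linarith
qed

text \<open>These bounds make the exponents of x and of y in \<open>weight\<close> positive, which
  is the source of the factor x y.\<close>

lemma total_exp_quotient_bounds:
  assumes "\<kappa> \<in> expfuns n" "supp_size n \<kappa> > 0" "n dvd total_exp n \<kappa>"
  shows "0 < total_exp n \<kappa> div n" "total_exp n \<kappa> div n < supp_size n \<kappa>"
  using total_exp_bounds[OF assms(1,2)] assms(3)
  by (auto simp: dvd_def)

lemma power_supp_size_dvd_prod_binomial: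
  assumes "prime n" "\<kappa> \<in> expfuns n"
  shows "n ^ supp_size n \<kappa> dvd (\<Prod>r<n. n choose \<kappa> r)"
  unfolding supp_size_def power_sum
  using assms expfuns_lt[OF assms(2)]
  by (intro prod_dvd_prod) (auto simp: prime_dvd_binomial of_bool_def)

lemma of_nat_mono_dvd: "m dvd k \<Longrightarrow> (of_nat m :: 'a :: comm_semiring_1) dvd of_nat k"
  by (auto simp: dvd_def)

lemma weight_dvd:
  assumes "prime n" "\<kappa> \<in> expfuns n" "n dvd total_exp n \<kappa>" "supp_size n \<kappa> > 0"
  shows "of_nat (n ^ supp_size n \<kappa>) * (var_x * var_y) dvd weight n \<kappa>"
proof -
  note b = total_exp_quotient_bounds[OF assms(2,4,3)]
  have "of_nat (n ^ supp_size n \<kappa>) * (var_x * var_y) dvd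
      of_nat (\<Prod>r<n. n choose \<kappa> r) *
      (var_x ^ (supp_size n \<kappa> - total_exp n \<kappa> div n) * var_y ^ (total_exp n \<kappa> div n))"
    using b by (intro mult_dvd_mono of_nat_mono_dvd power_supp_size_dvd_prod_binomial assms dvd_power) auto
  then show ?thesis
    unfolding weight_def by (simp add: mult.assoc)
qed

lemma supp_part_dvd:
  assumes "prime n" "j > 0"
  shows "of_nat (n ^ j) * (var_x * var_y) dvd supp_part n j"
  unfolding supp_part_def
proof (rule dvd_sum)
  fix \<kappa> assume \<kappa>: "\<kappa> \<in> expfuns n"
  show "of_nat (n ^ j) * (var_x * var_y) dvd
      of_bool (supp_size n \<kappa> = j) * of_int (moment_sign n \<kappa>) * weight n \<kappa>"
    using weight_dvd[OF assms(1) \<kappa>] assms(2)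
    by (cases "n dvd total_exp n \<kappa> \<and> supp_size n \<kappa> = j") (auto simp: moment_sign_def)
qed

text \<open>The quotient of the total exponent by n would be an integer strictly between 0 and
  1.\<close>

lemma supp_part_1: "supp_part n 1 = 0"
  unfolding supp_part_def
proof (intro sum.neutral ballI)
  fix \<kappa> assume \<kappa>: "\<kappa> \<in> expfuns n"
  have "\<not> n dvd total_exp n \<kappa>" if "supp_size n \<kappa> = 1"
    using total_exp_quotient_bounds[OF \<kappa>] that by auto
  then show "of_bool (supp_size n \<kappa> = 1) * of_int (moment_sign n \<kappa>) * weight n \<kappa> = 0"
    by (auto simp: moment_sign_def)
qed

section \<open>Double counting over the points of the support\<close>

definition rooted_supp_part :: "nat \<Rightarrow> nat \<Rightarrow> int_poly3" where
  "rooted_supp_part n j = (\<Sum>\<kappa>\<in>expfuns n. of_bool (\<kappa> 0 \<noteq> 0) *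
     (of_bool (supp_size n \<kappa> = j) * of_int (moment_sign n \<kappa>) * weight n \<kappa>))"

text \<open>
  Counting pairs of an exponent function and a point of its support; a translation
  moves that point to \<open>0\<close>.
\<close>

lemma supp_part_double_count:
  assumes "n > 0"
  shows "of_nat j * supp_part n j = of_nat n * rooted_supp_part n j"
proof -
  define F where "F \<kappa> = of_bool (supp_size n \<kappa> = j) * of_int (moment_sign n \<kappa>) * weight n \<kappa>" for \<kappa>
  have F: "F (affine_subst n 1 i \<kappa>) = F \<kappa>" for i \<kappa>
    using assms by (simp add: F_def supp_size_affine_subst moment_sign_shift[OF assms, simplified]
        weight_affine_subst)
  have "of_nat j * supp_part n j = (\<Sum>\<kappa>\<in>expfuns n. of_nat (supp_size n \<kappa>) * F \<kappa>)"
    unfolding supp_part_def F_def sum_distrib_left by (intro sum.cong) auto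
  also have "\<dots> = (\<Sum>\<kappa>\<in>expfuns n. \<Sum>i<n. of_bool (\<kappa> i \<noteq> 0) * F \<kappa>)"
    unfolding supp_size_def sum_distrib_right[symmetric] of_nat_sum of_nat_of_bool ..
  also have "\<dots> = (\<Sum>i<n. \<Sum>\<kappa>\<in>expfuns n. of_bool (\<kappa> i \<noteq> 0) * F \<kappa>)"
    by (rule sum.swap)
  also have "\<dots> = (\<Sum>i<n. rooted_supp_part n j)"
  proof (intro sum.cong refl)
    fix i assume "i \<in> {..<n}"
    then have "\<kappa> i = affine_subst n 1 i \<kappa> 0" for \<kappa>
      by (simp add: affine_subst_def)
    then have "(\<Sum>\<kappa>\<in>expfuns n. of_bool (\<kappa> i \<noteq> 0) * F \<kappa>) =
        (\<Sum>\<kappa>\<in>expfuns n. of_bool (affine_subst n 1 i \<kappa> 0 \<noteq> 0) * F (affine_subst n 1 i \<kappa>))"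
      by (simp only: F)
    also have "\<dots> = (\<Sum>\<kappa>\<in>expfuns n. of_bool (\<kappa> 0 \<noteq> 0) * F \<kappa>)"
      using assms by (intro sum_affine_subst[where F = "\<lambda>\<kappa>. of_bool (\<kappa> 0 \<noteq> 0) * F \<kappa>"]) simp_all
    finally show "(\<Sum>\<kappa>\<in>expfuns n. of_bool (\<kappa> i \<noteq> 0) * F \<kappa>) = rooted_supp_part n j"
      by (simp only: rooted_supp_part_def F_def)
  qed
  finally show ?thesis by simp
qed

lemma rooted_supp_part_dvd:
  assumes "prime n" "j > 0"
  shows "of_nat (n ^ j) * (var_x * var_y) dvd rooted_supp_part n j"
  unfolding rooted_supp_part_def
proof (rule dvd_sum)
  fix \<kappa> assume \<kappa>: "\<kappa> \<in> expfuns n"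
  show "of_nat (n ^ j) * (var_x * var_y) dvd of_bool (\<kappa> 0 \<noteq> 0) *
      (of_bool (supp_size n \<kappa> = j) * of_int (moment_sign n \<kappa>) * weight n \<kappa>)"
    using weight_dvd[OF assms(1) \<kappa>] assms(2)
    by (cases "n dvd total_exp n \<kappa> \<and> supp_size n \<kappa> = j") (auto simp: moment_sign_def)
qed

section \<open>Exponent functions with support of size two\<close>

definition pair_fun :: "nat \<Rightarrow> nat \<Rightarrow> nat \<Rightarrow> nat \<Rightarrow> nat" where
  "pair_fun n k i = restrict (\<lambda>r. if r = 0 then k else if r = i then n - k else 0) {..<n}"

lemma sum_pair_fun:
  fixes f :: "nat \<Rightarrow> nat \<Rightarrow> 'a :: comm_semiring_1"
  assumes "i \<in> {1..<n}" "\<And>r. f r 0 = 0"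
  shows "(\<Sum>r<n. f r (pair_fun n k i r)) = f 0 k + f i (n - k)"
proof -
  have "(\<Sum>r<n. f r (pair_fun n k i r)) = (\<Sum>r\<in>{0, i}. f r (pair_fun n k i r))"
    using assms by (intro sum.mono_neutral_right) (auto simp: pair_fun_def)
  then show ?thesis using assms by (simp add: pair_fun_def)
qed

lemma prod_pair_fun:
  fixes f :: "nat \<Rightarrow> 'a :: comm_semiring_1"
  assumes "i \<in> {1..<n}" "f 0 = 1"
  shows "(\<Prod>r<n. f (pair_fun n k i r)) = f k * f (n - k)"
proof -
  have "(\<Prod>r<n. f (pair_fun n k i r)) = (\<Prod>r\<in>{0, i}. f (pair_fun n k i r))"
    using assms by (intro prod.mono_neutral_right) (auto simp: pair_fun_def)
  then show ?thesis using assms by (simp add: pair_fun_def)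
qed

lemma pair_fun_simps:
  assumes "k \<in> {1..<n}" "i \<in> {1..<n}"
  shows "pair_fun n k i \<in> expfuns n" "pair_fun n k i 0 = k" "supp_size n (pair_fun n k i) = 2"
    "total_exp n (pair_fun n k i) = n" "moment n (pair_fun n k i) = i * (n - k)"
    "(\<Prod>r<n. n choose (pair_fun n k i r)) = (n choose k)\<^sup>2"
proof -
  show "pair_fun n k i \<in> expfuns n" "pair_fun n k i 0 = k"
    using assms by (auto simp: pair_fun_def expfuns_def)
  show "supp_size n (pair_fun n k i) = 2"
    using sum_pair_fun[OF assms(2), of "\<lambda>_ m. of_bool (m \<noteq> 0) :: nat" k] assms
    by (simp add: supp_size_def)
  show "total_exp n (pair_fun n k i) = n"
    using sum_pair_fun[OF assms(2), of "\<lambda>_ m. m" k] assms by (simp add: total_exp_def)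
  show "moment n (pair_fun n k i) = i * (n - k)"
    using sum_pair_fun[OF assms(2), of "\<lambda>r m. r * m" k] by (simp add: moment_def)
  show "(\<Prod>r<n. n choose (pair_fun n k i r)) = (n choose k)\<^sup>2"
    using prod_pair_fun[OF assms(2), of "\<lambda>m. n choose m" k] assms binomial_symmetric[of k n]
    by (simp add: power2_eq_square)
qed

text \<open>The quotient of the total exponent by \<open>n\<close> lies strictly between 0 and 2, so
  the two nonzero values add up to exactly \<open>n\<close>.\<close>

lemma supp_size_2_cases:
  assumes \<kappa>: "\<kappa> \<in> expfuns n" "supp_size n \<kappa> = 2" "\<kappa> 0 \<noteq> 0" "n dvd total_exp n \<kappa>"
  obtains i where "i \<in> {1..<n}" "\<kappa> 0 \<in> {1..<n}" "\<kappa> = pair_fun n (\<kappa> 0) i"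
proof -
  have "n > 0" using total_exp_bounds[OF \<kappa>(1)] \<kappa>(2) by (cases n) auto
  define S where "S = {r. r < n \<and> \<kappa> r \<noteq> 0}"
  have "card S = 2"
    using \<kappa>(2) by (simp add: S_def supp_size_def Int_def)
  moreover have "0 \<in> S" using \<open>n > 0\<close> \<kappa>(3) by (simp add: S_def)
  ultimately have "card (S - {0}) = 1" by simp
  then obtain i where "S - {0} = {i}" by (rule card_1_singletonE)
  then have i: "i \<noteq> 0" "S = {0, i}"
    using insert_Diff[OF \<open>0 \<in> S\<close>] by (metis Diff_iff insertI1, simp only:)
  then have "i \<in> S" by simp
  then have in_range: "i \<in> {1..<n}" "\<kappa> i \<noteq> 0"
    using i(1) by (simp_all add: S_def)
  have zero: "\<kappa> r = 0" if "r < n" "r \<noteq> 0" "r \<noteq> i" for r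
  proof -
    have "r \<notin> S" using that i(2) by simp
    then show ?thesis using that by (simp add: S_def)
  qed
  have "total_exp n \<kappa> = (\<Sum>r\<in>{0, i}. \<kappa> r)"
    unfolding total_exp_def using in_range zero by (intro sum.mono_neutral_right) auto
  then have tot: "total_exp n \<kappa> = \<kappa> 0 + \<kappa> i" using i(1) by simp
  have "total_exp n \<kappa> div n = 1"
    using total_exp_quotient_bounds[OF \<kappa>(1) _ \<kappa>(4)] \<kappa>(2) by simp
  then have "\<kappa> 0 + \<kappa> i = n" using dvd_div_mult_self[OF \<kappa>(4)] tot by simp
  then have "n - \<kappa> 0 = \<kappa> i" by simp
  then have "\<kappa> r = pair_fun n (\<kappa> 0) i r" for r
    using zero[of r] \<kappa>(1) by (simp add: pair_fun_def restrict_def expfuns_def PiE_def extensional_def)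
  then have "\<kappa> = pair_fun n (\<kappa> 0) i" by (rule ext)
  moreover have "\<kappa> 0 \<in> {1..<n}" using \<kappa>(3) expfuns_lt[OF \<kappa>(1) \<open>n > 0\<close>] by simp
  ultimately show ?thesis using that in_range by blast
qed

text \<open>The function with values k at 0 and n - k at i has moment i (n - k), never 0 modulo n,
  so its sign is -1 at moment 1 and 0 otherwise. Symmetry of the binomial coefficients turns its
  product into a square.\<close>

lemma rooted_supp_part_2:
  assumes "prime n"
  shows "rooted_supp_part n 2 = - (of_nat (\<Sum>k\<in>{1..<n}. (n choose k)\<^sup>2) *
    ((var_x + var_y + var_z) ^ (n - 2) * (var_x * var_y)))"
proof -
  let ?c = "(var_x + var_y + var_z) ^ (n - 2) * (var_x * var_y)"
  have n: "n > 1" using assms prime_gt_1_nat by auto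
  define A where "A = {\<kappa> \<in> expfuns n. supp_size n \<kappa> = 2 \<and> \<kappa> 0 \<noteq> 0 \<and> n dvd total_exp n \<kappa> \<and>
    moment n \<kappa> mod n = 1}"
  have cop: "coprime (n - k) n" if "k \<in> {1..<n}" for k
    using that prime_imp_coprime[OF assms, of "n - k"] nat_dvd_not_less[of "n - k" n]
    by (simp add: coprime_commute)
  have nonzero: "i * (n - k) mod n \<noteq> 0" if "k \<in> {1..<n}" "i \<in> {1..<n}" for i k
    using that nat_dvd_not_less[of "n - k" n] nat_dvd_not_less[of i n]
    by (simp add: prime_dvd_mult_iff[OF assms] flip: dvd_eq_mod_eq_0)
  \<comment> \<open>Moment 1 forces i to be the inverse of n - k modulo n, so each value k at 0
    occurs exactly once.\<close>
  have bij: "bij_betw (\<lambda>\<kappa>. \<kappa> 0) A {1..<n}"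
    unfolding bij_betw_def
  proof
    show "inj_on (\<lambda>\<kappa>. \<kappa> 0) A"
    proof (rule inj_onI)
      fix \<kappa> \<kappa>' assume AA: "\<kappa> \<in> A" "\<kappa>' \<in> A" and eq: "\<kappa> 0 = \<kappa>' 0"
      obtain i where i: "i \<in> {1..<n}" "\<kappa> 0 \<in> {1..<n}" "\<kappa> = pair_fun n (\<kappa> 0) i"
        using AA(1) supp_size_2_cases[of \<kappa> n] unfolding A_def by blast
      obtain i' where i': "i' \<in> {1..<n}" "\<kappa>' = pair_fun n (\<kappa> 0) i'"
        using AA(2) supp_size_2_cases[of \<kappa>' n] unfolding A_def eq by blast
      have "i * (n - \<kappa> 0) mod n = i' * (n - \<kappa> 0) mod n"
        using AA pair_fun_simps(5)[OF i(2,1)] pair_fun_simps(5)[OF i(2) i'(1)] i(3) i'(2)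
        by (simp add: A_def)
      then have "[i = i'] (mod n)"
        using cop[OF i(2)] by (simp flip: cong_def add: cong_mult_rcancel_nat coprime_commute)
      then have "i = i'" using i(1) i'(1) by (simp add: cong_def)
      then show "\<kappa> = \<kappa>'" using i(3) i'(2) by simp
    qed
    show "(\<lambda>\<kappa>. \<kappa> 0) ` A = {1..<n}"
    proof (intro equalityI subsetI)
      fix k assume "k \<in> (\<lambda>\<kappa>. \<kappa> 0) ` A"
      then show "k \<in> {1..<n}" using expfuns_lt[of _ n 0] n by (auto simp: A_def)
    next
      fix k assume k: "k \<in> {1..<n}"
      obtain x where x: "[(n - k) * x = Suc 0] (mod n)"
        using cong_solve_coprime_nat[OF cop[OF k]] by blast
      define i where "i = x mod n"
      have im: "i * (n - k) mod n = 1"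
        using x n by (simp add: i_def cong_def mult.commute[of "n - k"] mod_mult_left_eq)
      then have "i \<in> {1..<n}" using n by (cases "i = 0") (auto simp: i_def)
      with im have "pair_fun n k i \<in> A" "pair_fun n k i 0 = k"
        using pair_fun_simps[OF k, of i] k by (simp_all add: A_def)
      then show "k \<in> (\<lambda>\<kappa>. \<kappa> 0) ` A" by (metis image_eqI)
    qed
  qed
  have "rooted_supp_part n 2 = (\<Sum>\<kappa>\<in>A. - (of_nat ((n choose \<kappa> 0)\<^sup>2) * ?c))"
    unfolding rooted_supp_part_def
  proof (intro sum.mono_neutral_cong_right ballI)
    have term_eq: "of_int (moment_sign n \<kappa>) * weight n \<kappa> =
        - (of_bool (moment n \<kappa> mod n = 1) * (of_nat ((n choose \<kappa> 0)\<^sup>2) * ?c))"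
      if \<kappa>: "\<kappa> \<in> expfuns n" "supp_size n \<kappa> = 2" "\<kappa> 0 \<noteq> 0" "n dvd total_exp n \<kappa>" for \<kappa>
    proof -
      obtain k i where k: "k \<in> {1..<n}" and i: "i \<in> {1..<n}" and eq: "\<kappa> = pair_fun n k i"
        using \<kappa> by (elim supp_size_2_cases)
      have "of_int (moment_sign n \<kappa>) = (- of_bool (moment n \<kappa> mod n = 1) :: int_poly3)"
        using nonzero[OF k i] by (simp add: eq moment_sign_def pair_fun_simps[OF k i])
      moreover have "weight n \<kappa> = of_nat ((n choose \<kappa> 0)\<^sup>2) * ?c"
        using n unfolding weight_def eq pair_fun_simps[OF k i] by (simp add: mult_ac)
      ultimately show ?thesis by (simp only: mult_minus_left)
    qed
    show "of_bool (\<kappa> 0 \<noteq> 0) * (of_bool (supp_size n \<kappa> = 2) * of_int (moment_sign n \<kappa>) * weight n \<kappa>) = 0"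
      if "\<kappa> \<in> expfuns n - A" for \<kappa>
    proof (cases "\<kappa> 0 \<noteq> 0 \<and> supp_size n \<kappa> = 2 \<and> n dvd total_exp n \<kappa>")
      case True
      with that term_eq[of \<kappa>] show ?thesis by (auto simp: A_def)
    qed (auto simp: moment_sign_def)
    show "of_bool (\<kappa> 0 \<noteq> 0) * (of_bool (supp_size n \<kappa> = 2) * of_int (moment_sign n \<kappa>) * weight n \<kappa>) =
        - (of_nat ((n choose \<kappa> 0)\<^sup>2) * ?c)" if "\<kappa> \<in> A" for \<kappa>
      using that term_eq[of \<kappa>] by (simp add: A_def del: of_nat_power)
  qed (auto simp: A_def)
  also have "\<dots> = (\<Sum>k\<in>{1..<n}. - (of_nat ((n choose k)\<^sup>2) * ?c))"
    by (rule sum.reindex_bij_betw[OF bij])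
  also have "\<dots> = - (of_nat (\<Sum>k\<in>{1..<n}. (n choose k)\<^sup>2) * ?c)"
    by (simp only: sum_negf sum_distrib_right of_nat_sum)
  finally show ?thesis .
qed

section \<open>Assembly of the factors n^4, x y and z\<close>

text \<open>Bezout writes \<open>V\<close> as a combination of j V and m V; the first is divisible
  by m w by assumption, the second because \<open>w\<close> divides \<open>V\<close>.\<close>

lemma coprime_of_nat_dvd_cancel:
  fixes V w :: "'a :: comm_ring_1"
  assumes "coprime j m" "of_nat m * w dvd of_nat j * V" "w dvd V"
  shows "of_nat m * w dvd V"
proof -
  obtain u v where "u * int j + v * int m = 1"
    using assms(1) bezout_int[of "int j" "int m"] by auto
  then have "V = of_int (u * int j + v * int m) * V" by simp
  also have "\<dots> = of_int u * (of_nat j * V) + of_int v * (of_nat m * V)"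
    by (simp add: algebra_simps)
  also have "of_nat m * w dvd \<dots>"
    by (intro dvd_add dvd_mult[OF assms(2)] dvd_mult[OF mult_dvd_mono[OF dvd_refl assms(3)]])
  finally show ?thesis .
qed

lemma power_4_dvd_supp_part:
  assumes "prime n" "n \<ge> 5" "j \<ge> 1"
  shows "of_nat (n ^ 4) * (var_x * var_y) dvd supp_part n j"
proof -
  consider "j = 1" | "j = 2 \<or> j = 3" | "j \<ge> 4" using assms(3) by linarith
  then show ?thesis
  proof cases
    case 1
    then show ?thesis by (simp only: supp_part_1 dvd_0_right)
  next
    case 2
    have "of_nat (n ^ 3) * (var_x * var_y) dvd rooted_supp_part n 2"
      unfolding rooted_supp_part_2[OF assms(1)] dvd_minus_iff
      by (intro mult_dvd_mono[OF of_nat_mono_dvd dvd_triv_right] prime_cube_dvd_sum_binomial_squares assms)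
    \<comment> \<open>For \<open>j = 3\<close> the support size alone supplies three factors
      \<open>n\<close>.\<close>
    then have "of_nat (n ^ 3) * (var_x * var_y) dvd rooted_supp_part n j"
      using 2 rooted_supp_part_dvd[OF assms(1), of 3] by auto
    \<comment> \<open>Double counting supplies the fourth factor \<open>n\<close> at the price of a
      factor \<open>j\<close>, which is 2 or 3 and hence coprime to \<open>n\<close>.\<close>
    then have "of_nat n * (of_nat (n ^ 3) * (var_x * var_y)) dvd of_nat j * supp_part n j"
      using assms(2) supp_part_double_count[of n j] by (simp only:) (intro mult_dvd_mono; simp)
    also have "of_nat n * (of_nat (n ^ 3) * (var_x * var_y)) = of_nat (n ^ 4) * (var_x * var_y)"
      by (simp add: eval_nat_numeral mult.assoc)
    finally have "of_nat (n ^ 4) * (var_x * var_y) dvd of_nat j * supp_part n j" .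
    moreover have "var_x * var_y dvd supp_part n j"
      using supp_part_dvd[OF assms(1), of j] assms(3) dvd_mult_right by auto
    moreover have "\<not> n dvd j"
      using 2 assms(2) nat_dvd_not_less[of j n] by linarith
    then have "coprime j (n ^ 4)"
      using prime_imp_coprime[OF assms(1), of j] by (simp add: coprime_commute[of j])
    ultimately show ?thesis
      using coprime_of_nat_dvd_cancel by blast
  next
    case 3
    then have "of_nat (n ^ 4) * (var_x * var_y) dvd of_nat (n ^ j) * (var_x * var_y)"
      by (intro mult_dvd_mono of_nat_mono_dvd le_imp_power_dvd dvd_refl)
    then show ?thesis
      using supp_part_dvd[OF assms(1), of j] assms(3) by (auto intro: dvd_trans)
  qed
qed

lemma p_int_diff_dvd:
  assumes "prime n" "n \<ge> 5"
  shows "of_nat (n ^ 4) * (var_x * var_y) dvd p_int n - (var_x + var_y + var_z) ^ n"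
proof -
  have "p_int n = supp_part n 0 + (\<Sum>j\<in>{1..n}. supp_part n j)"
    unfolding p_int_eq_sum_supp_part atMost_atLeast0 One_nat_def
    by (rule sum.atLeast_Suc_atMost) simp
  also have "supp_part n 0 = (var_x + var_y + var_z) ^ n"
    using assms(2) by (intro supp_part_0) simp
  finally have "p_int n - (var_x + var_y + var_z) ^ n = (\<Sum>j\<in>{1..n}. supp_part n j)"
    by (simp only: add_diff_cancel_left')
  also have "of_nat (n ^ 4) * (var_x * var_y) dvd \<dots>"
    by (intro dvd_sum power_4_dvd_supp_part assms) simp
  finally show ?thesis .
qed

text \<open>Setting the outermost variable to 0 in P = c G gives c G(0) = 0 in an integral domain,
  so G(0) = 0 and z divides the cofactor \<open>G\<close>.\<close>

lemma var_z_mult_dvdI: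
  assumes "[:c:] dvd P" "var_z dvd P" "c \<noteq> 0"
  shows "[:c:] * var_z dvd P"
proof -
  obtain G where G: "P = [:c:] * G" using assms(1) by (rule dvdE)
  have "poly P 0 = 0" using assms(2) by (simp add: var_z_def poly_eq_0_iff_dvd)
  then have "poly G 0 = 0" using G assms(3) by simp
  then have "var_z dvd G" by (simp add: var_z_def poly_eq_0_iff_dvd)
  then show ?thesis unfolding G by (intro mult_dvd_mono dvd_refl)
qed

theorem proposition8:
  fixes n :: nat and \<epsilon> :: complex
  assumes "prime n" and "n \<ge> 5" and "primitive_root_of_unity n \<epsilon>"
  shows "of_nat (n ^ 4) * var_x * var_y * var_z dvd
           p_poly n \<epsilon> - (var_x + var_y + var_z) ^ n"
proof -
  have "odd n" using assms(1,2) by (intro prime_odd_nat) auto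
  \<comment> \<open>Since z is outermost, n^4 x y is a constant polynomial in z; \<open>?c\<close>
    is that constant.\<close>
  let ?c = "of_nat (n ^ 4) * ([:[:0, 1:]:] * [:0, 1:]) :: int poly poly"
  have c: "of_nat (n ^ 4) * var_x * var_y = [:?c:]"
    by (simp add: var_x_def var_y_def of_nat_poly mult.assoc)
  have "[:?c:] * var_z dvd p_int n - (var_x + var_y + var_z) ^ n"
  proof (rule var_z_mult_dvdI)
    show "[:?c:] dvd p_int n - (var_x + var_y + var_z) ^ n"
      using p_int_diff_dvd[OF assms(1,2)] by (simp only: mult.assoc flip: c)
    show "var_z dvd p_int n - (var_x + var_y + var_z) ^ n"
      by (rule var_z_dvd_p_int_diff[OF assms(3,1) \<open>odd n\<close>])
    show "?c \<noteq> 0" using assms(2) by simp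
  qed
  then show ?thesis
    unfolding p_poly_eq_p_int[OF assms(3,1) \<open>odd n\<close>] c .
qed

end
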